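(* Let $T$ be a finite set, and let $a_t$ be an integer for every $t\in T$. Then there exists a finite holey subset $S$ of $\mathbb{Z}$ such that \[ \sum_{t\in T} f_{n+a_t} = \sum_{s\in S} f_{n+s} \] for every $n\in\mathbb{Z}$ which satisfies $n>\max\left(\{-a_t \mid t\in T\}\cup\{-s\mid s\in S\}\right)$.
   Context: A subset $S$ of $\mathbb{Z}$ is called holey if $s+1\notin S$ for every $s\in S$ (i.e., no two elements of $S$ are consecutive integers). $(f_1,f_2,f_3,\dots)$ denotes the Fibonacci sequence, defined by $f_1=f_2=1$ and $f_n=f_{n-1}+f_{n-2}$ for all integers $n\ge 3$; $f_m$ is only defined for positive integers $m$. *)

theory Defs
  imports "HOL-Number_Theory.Fib"
begin

definition holey :: "int set \<Rightarrow> bool" where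
  "holey S \<longleftrightarrow> (\<forall>s\<in>S. s + 1 \<notin> S)"

end

theory Submission
  imports Defs
begin

text \<open>
  Extending the Fibonacci sequence to negative indices makes the bound on \<open>n\<close> irrelevant: it
  suffices to match the two sums for every two-sided solution \<open>F\<close> of the Fibonacci recurrence.
  The elements of \<open>T\<close> are added to a holey set one at a time, using the rewriting rules
  \<open>F m + F (m + 1) = F (m + 2)\<close> and \<open>2 * F m = F (m + 1) + F (m - 2)\<close>.  Rewriting terminates
  because the first rule decreases the number of summands, and the second one moves the summand
  still to be inserted below one more element of the set.
\<close>

definition fib_rec :: "(int \<Rightarrow> int) \<Rightarrow> bool" where
  "fib_rec F \<longleftrightarrow> (\<forall>n. F (n + 2) = F (n + 1) + F n)"

lemma fib_recD: "fib_rec F \<Longrightarrow> F (n + 2) = F (n + 1) + F n"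
  by (simp add: fib_rec_def)

lemma fib_rec_double:
  assumes "fib_rec F"
  shows "2 * F n = F (n + 1) + F (n - 2)"
  using fib_recD[OF assms, of "n - 1"] fib_recD[OF assms, of "n - 2"]
  by (simp add: algebra_simps)

lemma fib_rec_shift: "fib_rec F \<Longrightarrow> fib_rec (\<lambda>x. F (n + x))"
  by (simp add: fib_rec_def flip: add.assoc)

text \<open>The extension to negative indices by f_{-k} = (-1)^(k+1) f_k, the only one that
  satisfies the recurrence.\<close>

definition int_fib :: "int \<Rightarrow> int" where
  "int_fib n = (if n \<ge> 0 then int (fib (nat n)) else (-1) ^ (nat (-n) + 1) * int (fib (nat (-n))))"

lemma fib_rec_int_fib: "fib_rec int_fib"
  unfolding fib_rec_def
proof
  fix n :: int
  \<comment> \<open>At \<open>n = -1\<close> the recurrence straddles both branches of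
    \<open>int_fib\<close>. The last form makes all three indices nonpositive; for
    \<open>k = 0\<close> the index \<open>n + 2 = 0\<close> falls in the first branch, but both
    formulas give 0 there.\<close>
  consider k where "n = int k" | "n = -1" | k where "n = - int k - 2"
  proof -
    have "n = int (nat n) \<or> n = -1 \<or> n = - int (nat (-n - 2)) - 2"
      by linarith
    then show ?thesis
      using that by blast
  qed
  then show "int_fib (n + 2) = int_fib (n + 1) + int_fib n"
  proof cases
    case 1
    then have "nat (n + 2) = Suc (Suc k)" "nat (n + 1) = Suc k"
      by auto
    with 1 show ?thesis
      by (simp add: int_fib_def)
  next
    case 2
    then show ?thesis
      by (simp add: int_fib_def)
  next
    case 3
    then have "nat (- n) = Suc (Suc k)" "nat (- (n + 1)) = Suc k" "nat (- (n + 2)) = k"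
      by auto
    with 3 show ?thesis
      by (auto simp: int_fib_def algebra_simps)
  qed
qed

lemma holey_Diff: "holey S \<Longrightarrow> holey (S - A)"
  by (auto simp: holey_def)

lemma holey_insert:
  assumes "holey S" "a - 1 \<notin> S" "a + 1 \<notin> S"
  shows "holey (insert a S)"
  using assms by (auto simp: holey_def)

text \<open>The cardinality bound is what allows the induction hypothesis to be applied twice in a row.\<close>

lemma holey_add_index:
  assumes "finite S" "holey S"
  shows "\<exists>S'. finite S' \<and> holey S' \<and> card S' \<le> Suc (card S) \<and>
    (\<forall>F. fib_rec F \<longrightarrow> sum F S' = F a + sum F S)"
  using assms
\<comment> \<open>The order is lexicographic. Every recursive case except \<open>move\<close> lowers
  \<open>card S\<close>; \<open>move\<close> keeps it and lowers the second component.\<close>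
proof (induction "(S, a)" arbitrary: S a rule: wf_induct_rule
    [OF wf_measures[of "[\<lambda>(S, a). card S, \<lambda>(S, a). card {s \<in> S. s \<le> (a :: int)}]"]])
  case (1 S a)
  note fin = \<open>finite S\<close> and holey = \<open>holey S\<close>
  have IH: "\<exists>S'. finite S' \<and> holey S' \<and> card S' \<le> Suc (card R) \<and>
      (\<forall>F. fib_rec F \<longrightarrow> sum F S' = F b + sum F R)"
    if "finite R" "holey R"
      "card R < card S \<or> card R = card S \<and> card {s \<in> R. s \<le> b} < card {s \<in> S. s \<le> a}" for R b
    using 1(1)[of R b] that by auto
  consider (isolated) "a \<notin> S" "a - 1 \<notin> S" "a + 1 \<notin> S" | (above) "a + 1 \<in> S"
    | (below) "a - 1 \<in> S" | (move) "a \<in> S" "a + 2 \<notin> S" | (merge) "a \<in> S" "a + 2 \<in> S"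
    by blast
  then show ?case
  proof cases
    case isolated
    then show ?thesis
      using fin holey by (intro exI[of _ "insert a S"]) (simp add: holey_insert)
  next
    \<comment> \<open>The summand \<open>a\<close> and its neighbour \<open>a + 1\<close> fuse into
      \<open>a + 2\<close>, which is inserted into a smaller set. The case \<open>below\<close> is
      the same with \<open>a - 1\<close> and \<open>a + 1\<close>.\<close>
    case above
    obtain S' where S': "finite S'" "holey S'" "card S' \<le> Suc (card (S - {a + 1}))"
      "\<And>F. fib_rec F \<Longrightarrow> sum F S' = F (a + 2) + sum F (S - {a + 1})"
      using IH[of "S - {a + 1}" "a + 2"] fin holey above card_Diff1_less[OF fin above]
      by (auto simp: holey_Diff)
    have "sum F S' = F a + sum F S" if "fib_rec F" for F
      using S'(4)[OF that] fib_recD[OF that, of a] sum.remove[OF fin above, of F] by simp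
    then show ?thesis
      using S' card_Diff1_less[OF fin above] by (intro exI[of _ S']) auto
  next
    case below
    obtain S' where S': "finite S'" "holey S'" "card S' \<le> Suc (card (S - {a - 1}))"
      "\<And>F. fib_rec F \<Longrightarrow> sum F S' = F (a + 1) + sum F (S - {a - 1})"
      using IH[of "S - {a - 1}" "a + 1"] fin holey below card_Diff1_less[OF fin below]
      by (auto simp: holey_Diff)
    have "sum F S' = F a + sum F S" if "fib_rec F" for F
      using S'(4)[OF that] fib_recD[OF that, of "a - 1"] sum.remove[OF fin below, of F]
      by (simp add: add.commute)
    then show ?thesis
      using S' card_Diff1_less[OF fin below] by (intro exI[of _ S']) auto
  next
    case move
    have notin: "a + 1 \<notin> S"
      using holey move(1) by (auto simp: holey_def)
    \<comment> \<open>The doubled \<open>a\<close> becomes \<open>a + 1\<close> and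
      \<open>a - 2\<close>. Since \<open>a + 2\<close> is absent and \<open>a\<close> is removed,
      \<open>a + 1\<close> can join at once; \<open>a - 2\<close> is left to insert.\<close>
    define R where "R = insert (a + 1) (S - {a})"
    have R: "finite R" "holey R" "card R = card S"
      using fin holey move notin card_Suc_Diff1[OF fin move(1)]
      by (auto simp: R_def add.assoc intro!: holey_insert holey_Diff)
    \<comment> \<open>The new element \<open>a + 1\<close> exceeds the bound \<open>a - 2\<close>,
      and \<open>a\<close> itself is no longer counted.\<close>
    have "{s \<in> R. s \<le> a - 2} \<subset> {s \<in> S. s \<le> a}"
      using move(1) by (auto simp: R_def)
    then have "card {s \<in> R. s \<le> a - 2} < card {s \<in> S. s \<le> a}"
      using fin by (intro psubset_card_mono) auto
    then obtain S' where S': "finite S'" "holey S'" "card S' \<le> Suc (card R)"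
      "\<And>F. fib_rec F \<Longrightarrow> sum F S' = F (a - 2) + sum F R"
      using IH[of R "a - 2"] R by auto
    have "sum F S' = F a + sum F S" if "fib_rec F" for F
    proof -
      have "sum F R = F (a + 1) + sum F (S - {a})"
        using fin notin by (simp add: R_def)
      then show ?thesis
        using S'(4)[OF that] fib_rec_double[OF that, of a] sum.remove[OF fin move(1), of F] by simp
    qed
    then show ?thesis
      using S' R by (intro exI[of _ S']) auto
  next
    case merge
    \<comment> \<open>Here \<open>a + 1\<close> would touch \<open>a + 2\<close>, so these two fuse
      as well: \<open>2 * F a + F (a + 2) = F (a - 2) + F (a + 3)\<close>.\<close>
    define R where "R = S - {a} - {a + 2}"
    have in2: "a + 2 \<in> S - {a}" and fin1: "finite (S - {a})"
      using merge fin by auto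
    have R: "finite R" "holey R" "Suc (Suc (card R)) = card S"
      using fin holey card_Suc_Diff1[OF fin merge(1)] card_Suc_Diff1[OF fin1 in2]
      by (auto simp: R_def intro!: holey_Diff)
    obtain Q where Q: "finite Q" "holey Q" "card Q \<le> Suc (card R)"
      "\<And>F. fib_rec F \<Longrightarrow> sum F Q = F (a + 3) + sum F R"
      using IH[of R "a + 3"] R by auto
    \<comment> \<open>\<open>R\<close> has two elements fewer than \<open>S\<close>, so
      \<open>card Q < card S\<close> and a second insertion is allowed.\<close>
    obtain S' where S': "finite S'" "holey S'" "card S' \<le> Suc (card Q)"
      "\<And>F. fib_rec F \<Longrightarrow> sum F S' = F (a - 2) + sum F Q"
      using IH[of Q "a - 2"] Q R by auto
    have "sum F S' = F a + sum F S" if "fib_rec F" for F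
    proof -
      have "sum F S = F a + (F (a + 2) + sum F R)"
        using sum.remove[OF fin merge(1), of F] sum.remove[OF fin1 in2, of F] by (simp add: R_def)
      then show ?thesis
        using S'(4)[OF that] Q(4)[OF that] fib_rec_double[OF that, of a]
          fib_recD[OF that, of "a + 1"] by (simp add: add.assoc)
    qed
    then show ?thesis
      using S' Q R by (intro exI[of _ S']) auto
  qed
qed

text \<open>\<open>S\<close> is chosen before \<open>F\<close>. Hence one \<open>S\<close> serves
  every \<open>n\<close>, by applying the identity to the shifts of a single solution.\<close>

lemma holey_sum_indices:
  fixes a :: "'a \<Rightarrow> int"
  assumes "finite T"
  shows "\<exists>S. finite S \<and> holey S \<and> (\<forall>F. fib_rec F \<longrightarrow> (\<Sum>t\<in>T. F (a t)) = sum F S)"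
  using assms
proof (induction T)
  case empty
  show ?case
    by (intro exI[of _ "{}"]) (simp add: holey_def)
next
  case (insert t T)
  then obtain S where "finite S" "holey S" "\<And>F. fib_rec F \<Longrightarrow> (\<Sum>t\<in>T. F (a t)) = sum F S"
    by auto
  then show ?case
    using holey_add_index[of S "a t"] insert.hyps by auto
qed

(* The bound on n is stated elementwise; it is vacuous when T and S are both empty.
   It makes every argument of nat positive, so nat never truncates. *)
theorem theorem8:
  fixes T :: "'a set" and a :: "'a \<Rightarrow> int"
  assumes "finite T"
  shows "\<exists>S :: int set. finite S \<and> holey S \<and>
    (\<forall>n :: int. (\<forall>m \<in> {- a t |t. t \<in> T} \<union> {- s |s. s \<in> S}. n > m) \<longrightarrow>
      (\<Sum>t\<in>T. fib (nat (n + a t))) = (\<Sum>s\<in>S. fib (nat (n + s))))"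
proof -
  obtain S where S: "finite S" "holey S"
    "\<And>F. fib_rec F \<Longrightarrow> (\<Sum>t\<in>T. F (a t)) = sum F S"
    using holey_sum_indices[OF assms, of a] by auto
  have "(\<Sum>t\<in>T. fib (nat (n + a t))) = (\<Sum>s\<in>S. fib (nat (n + s)))"
    if n: "\<forall>m \<in> {- a t |t. t \<in> T} \<union> {- s |s. s \<in> S}. n > m" for n
  proof -
    have T_pos: "n + a t \<ge> 0" if "t \<in> T" for t
    proof -
      have "n > - a t"
        using n that by blast
      then show ?thesis by simp
    qed
    have S_pos: "n + s \<ge> 0" if "s \<in> S" for s
    proof -
      have "n > - s"
        using n that by blast
      then show ?thesis by simp
    qed
    \<comment> \<open>The bound on \<open>n\<close> is used only here and for \<open>S\<close>
      below, to replace \<open>fib\<close> by \<open>int_fib\<close>.\<close>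
    have "int (\<Sum>t\<in>T. fib (nat (n + a t))) = (\<Sum>t\<in>T. int_fib (n + a t))"
      using T_pos by (simp add: int_fib_def)
    also have "\<dots> = (\<Sum>s\<in>S. int_fib (n + s))"
      by (rule S(3)[OF fib_rec_shift[OF fib_rec_int_fib]])
    also have "\<dots> = int (\<Sum>s\<in>S. fib (nat (n + s)))"
      using S_pos by (simp add: int_fib_def)
    finally show ?thesis
      by (simp only: of_nat_eq_iff)
  qed
  with S(1,2) show ?thesis
    by blast
qed

end
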